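(* Let $r,s,t$ be pairwise distinct positive integers, $n=r+s+t$ and $d=\gcd(r,s,t)$. The monodromy group of each of the two trees with passport $[r,s,t;3,1^{n-3};n]$ is isomorphic to a semidirect product $$\begin{cases}(A_{n/d})^d\rtimes \mathbb{Z}_{2d} & \text{if } n/d \text{ is even},\\ (A_{n/d})^d\rtimes \mathbb{Z}_{d} & \text{if } n/d\text{ is odd}.\end{cases}$$
   Context: A tree is a bicolored (black/white) plane tree, up to color- and orientation-preserving isomorphism. The passport $[\alpha;\beta;n]$ of a tree with $n$ edges records the partition $\alpha\vdash n$ of black vertex degrees and the partition $\beta\vdash n$ of white vertex degrees ($k^m$ means $k$ repeated $m$ times). Label the edges by $1,\dots,n$; let $\sigma_0\in S_n$ (resp. $\sigma_1$) be the permutation whose cycles are the cyclic orders of edges around the black (resp. white) vertices. The monodromy group of the tree is $\langle\sigma_0,\sigma_1\rangle\le S_n$ (well defined up to conjugacy). For pairwise distinct $r,s,t$ there are exactly two trees with passport $[r,s,t;3,1^{n-3};n]$. $A_m$ is the alternating group and $\mathbb{Z}_m$ the cyclic group of order $m$. *)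

theory Defs
  imports "HOL-Algebra.Algebra" "HOL-Combinatorics.Combinatorics"
begin

text \<open>
  A bicolored plane map with edges labelled \<open>1, \<dots>, num_edges\<close>: the edge \<open>e\<close> joins the black
  vertex \<open>black_end e\<close> to the white vertex \<open>white_end e\<close>, and \<open>black_rot e\<close> (resp. \<open>white_rot e\<close>)
  is the edge following \<open>e\<close> in the cyclic order around its black (resp. white) end.
  These cyclic orders determine a plane tree up to color- and orientation-preserving isomorphism.
\<close>

record ('b, 'w) bicolored_map =
  blacks :: "'b set"
  whites :: "'w set"
  num_edges :: nat
  black_end :: "nat \<Rightarrow> 'b"
  white_end :: "nat \<Rightarrow> 'w"
  black_rot :: "nat \<Rightarrow> nat"
  white_rot :: "nat \<Rightarrow> nat"

definition edge_set :: "('b, 'w) bicolored_map \<Rightarrow> nat set" where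
  "edge_set T = {1..num_edges T}"

definition vertices :: "('b, 'w) bicolored_map \<Rightarrow> ('b + 'w) set" where
  "vertices T = blacks T <+> whites T"

definition joins :: "('b, 'w) bicolored_map \<Rightarrow> nat \<Rightarrow> 'b + 'w \<Rightarrow> 'b + 'w \<Rightarrow> bool" where
  "joins T e u v \<longleftrightarrow> e \<in> edge_set T \<and> {u, v} = {Inl (black_end T e), Inr (white_end T e)}"

text \<open>
  A step \<open>(e, w)\<close> of a walk traverses the edge \<open>e\<close> and arrives at the vertex \<open>w\<close>. Recording the
  edges makes two parallel edges a cycle of length two.
\<close>

primrec walk ::
  "('b, 'w) bicolored_map \<Rightarrow> 'b + 'w \<Rightarrow> (nat \<times> ('b + 'w)) list \<Rightarrow> 'b + 'w \<Rightarrow> bool" where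
  "walk T u [] v \<longleftrightarrow> u \<in> vertices T \<and> u = v"
| "walk T u (p # ps) v \<longleftrightarrow> joins T (fst p) u (snd p) \<and> walk T (snd p) ps v"

definition is_cycle ::
  "('b, 'w) bicolored_map \<Rightarrow> 'b + 'w \<Rightarrow> (nat \<times> ('b + 'w)) list \<Rightarrow> bool" where
  "is_cycle T v ps \<longleftrightarrow>
     ps \<noteq> [] \<and> walk T v ps v \<and> distinct (map fst ps) \<and> distinct (map snd ps)"

definition black_star :: "('b, 'w) bicolored_map \<Rightarrow> 'b \<Rightarrow> nat set" where
  "black_star T b = {e \<in> edge_set T. black_end T e = b}"

definition white_star :: "('b, 'w) bicolored_map \<Rightarrow> 'w \<Rightarrow> nat set" where
  "white_star T w = {e \<in> edge_set T. white_end T e = w}"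

locale bicolored_plane_tree =
  fixes T :: "('b, 'w) bicolored_map"
  assumes finite_blacks: "finite (blacks T)"
    and finite_whites: "finite (whites T)"
    and black_end_in: "e \<in> edge_set T \<Longrightarrow> black_end T e \<in> blacks T"
    and white_end_in: "e \<in> edge_set T \<Longrightarrow> white_end T e \<in> whites T"
    and nonempty: "vertices T \<noteq> {}"
    and connected: "u \<in> vertices T \<Longrightarrow> v \<in> vertices T \<Longrightarrow> \<exists>ps. walk T u ps v"
    and acyclic: "\<not> is_cycle T v ps"
    and black_rot_permutes: "black_rot T permutes edge_set T"
    and white_rot_permutes: "white_rot T permutes edge_set T"
    \<comment> \<open>The edges around each vertex form one cycle (of length 1 at a leaf).\<close>
    and black_rot_cycle:
      "e \<in> edge_set T \<Longrightarrow> Orbits.orbit (black_rot T) e = black_star T (black_end T e)"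
    and white_rot_cycle:
      "e \<in> edge_set T \<Longrightarrow> Orbits.orbit (white_rot T) e = white_star T (white_end T e)"

definition passport :: "('b, 'w) bicolored_map \<Rightarrow> nat multiset \<times> nat multiset \<times> nat" where
  "passport T =
     (image_mset (\<lambda>b. card (black_star T b)) (mset_set (blacks T)),
      image_mset (\<lambda>w. card (white_star T w)) (mset_set (whites T)),
      num_edges T)"

definition monodromy_group :: "('b, 'w) bicolored_map \<Rightarrow> (nat \<Rightarrow> nat) monoid" where
  "monodromy_group T = subgroup_generated (sym_group (num_edges T)) {black_rot T, white_rot T}"

text \<open>The outer semidirect product \<open>N \<rtimes> K\<close> for an action \<open>\<phi> \<in> hom K (AutoGroup N)\<close>.\<close>

definition semidirect_product ::
  "('a, 'c) monoid_scheme \<Rightarrow> ('k, 'd) monoid_scheme \<Rightarrow> ('k \<Rightarrow> 'a \<Rightarrow> 'a) \<Rightarrow> ('a \<times> 'k) monoid" where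
  "semidirect_product N K \<phi> =
     \<lparr>carrier = carrier N \<times> carrier K,
      monoid.mult = (\<lambda>(a, x) (b, y). (a \<otimes>\<^bsub>N\<^esub> \<phi> x b, x \<otimes>\<^bsub>K\<^esub> y)),
      one = (\<one>\<^bsub>N\<^esub>, \<one>\<^bsub>K\<^esub>)\<rparr>"

end

theory Submission
  imports Defs
begin

text \<open>
  Write \<open>\<sigma>\<close> and \<open>\<tau>\<close> for the black and the white rotation. Then \<open>\<tau>\<close> is a 3-cycle whose three edges lie on
  the three different black vertices (two on the same one would give a cycle of length 2), so
  \<open>Z = \<sigma> \<circ> \<tau>\<close> is an \<open>n\<close>-cycle. Numbering the edges along \<open>Z\<close> by residues modulo \<open>n\<close>, consecutive
  edges of \<open>\<tau>\<close> differ by the black degrees, so \<open>\<tau>\<close> acts inside one residue class modulo \<open>d\<close>.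

  Say that two points are linked if some 3-cycle of the group contains both. This is an equivalence
  relation, and every 3-cycle on pairwise linked points belongs to the group. Conjugating \<open>\<tau>\<close> by
  powers of \<open>Z\<close> shows that shifts by each black degree, hence by \<open>d\<close>, preserve links. So the group
  contains the alternating group of each residue class modulo \<open>d\<close>, and it is generated by these
  \<open>d\<close> groups together with \<open>Z\<close>. A complement to their product is generated by a permutation \<open>W\<close>
  which shifts the classes cyclically and whose \<open>d\<close>-th power is the identity (\<open>n / d\<close> odd) or one
  transposition in each class (\<open>n / d\<close> even).
\<close>

subsection \<open>Inner semidirect products\<close>

text \<open>Moving \<open>k x\<close> past \<open>f a\<close> stays within the image of
  \<open>N\<close>, so the product set is closed under products and inverses. To bound a generated
  group by such a set it then suffices to check generators.\<close>

lemma subgroup_product_of_homs: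
  fixes G (structure)
  assumes "group G" "group N" "group K" and f: "f \<in> hom N G" and k: "k \<in> hom K G"
    and norm: "\<And>x a. \<lbrakk>x \<in> carrier K; a \<in> carrier N\<rbrakk> \<Longrightarrow>
      \<exists>b\<in>carrier N. k x \<otimes> f a = f b \<otimes> k x"
  shows "subgroup {f a \<otimes> k x |a x. a \<in> carrier N \<and> x \<in> carrier K} G" (is "subgroup ?U G")
proof -
  interpret G: group G by fact
  interpret N: group N by fact
  interpret K: group K by fact
  interpret f: group_hom N G f by unfold_locales (rule f)
  interpret k: group_hom K G k by unfold_locales (rule k)
  show ?thesis
  proof
    show "?U \<subseteq> carrier G" by auto
    show "\<one> \<in> ?U"
      by (rule CollectI, rule exI[of _ "\<one>\<^bsub>N\<^esub>"], rule exI[of _ "\<one>\<^bsub>K\<^esub>"]) simp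
  next
    fix u v assume "u \<in> ?U" "v \<in> ?U"
    then obtain a x b y where u: "u = f a \<otimes> k x" "a \<in> carrier N" "x \<in> carrier K"
      and v: "v = f b \<otimes> k y" "b \<in> carrier N" "y \<in> carrier K" by blast
    obtain c where c: "c \<in> carrier N" "k x \<otimes> f b = f c \<otimes> k x" using norm u v by blast
    have "u \<otimes> v = f a \<otimes> (k x \<otimes> f b) \<otimes> k y" using u v by (simp add: G.m_assoc)
    also have "\<dots> = f (a \<otimes>\<^bsub>N\<^esub> c) \<otimes> k (x \<otimes>\<^bsub>K\<^esub> y)" unfolding c using u v c(1) by (simp add: G.m_assoc)
    finally show "u \<otimes> v \<in> ?U" using u v c(1) by blast
  next
    fix u assume "u \<in> ?U"
    then obtain a x where u: "u = f a \<otimes> k x" "a \<in> carrier N" "x \<in> carrier K" by blast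
    obtain c where c: "c \<in> carrier N"
      "k (inv\<^bsub>K\<^esub> x) \<otimes> f (inv\<^bsub>N\<^esub> a) = f c \<otimes> k (inv\<^bsub>K\<^esub> x)" using norm u by blast
    have "inv u = k (inv\<^bsub>K\<^esub> x) \<otimes> f (inv\<^bsub>N\<^esub> a)" using u by (simp add: G.inv_mult_group)
    then have "inv u = f c \<otimes> k (inv\<^bsub>K\<^esub> x)" unfolding c(2) .
    then show "inv u \<in> ?U"
      by (intro CollectI exI[of _ c] exI[of _ "inv\<^bsub>K\<^esub> x"]) (use c(1) u(3) in simp)
  qed
qed

text \<open>An inner semidirect product is an outer one. The action is read off from
  \<open>norm\<close>; \<open>triv\<close> lets \<open>k x\<close> fall into the image of
  \<open>N\<close> only for the identity, which makes factorizations unique.\<close>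

lemma isomorphic_semidirect_product:
  fixes G (structure)
  assumes "group G" "group N" "group K"
    and f: "f \<in> hom N G" and inj: "inj_on f (carrier N)" and k: "k \<in> hom K G"
    and norm: "\<And>x a. \<lbrakk>x \<in> carrier K; a \<in> carrier N\<rbrakk> \<Longrightarrow>
      \<exists>b\<in>carrier N. k x \<otimes> f a = f b \<otimes> k x"
    and triv: "\<And>x a. \<lbrakk>x \<in> carrier K; a \<in> carrier N; k x = f a\<rbrakk> \<Longrightarrow> x = \<one>\<^bsub>K\<^esub>"
    and surj: "carrier G \<subseteq> {f a \<otimes> k x |a x. a \<in> carrier N \<and> x \<in> carrier K}"
  shows "\<exists>\<phi>\<in>hom K (AutoGroup N). G \<cong> semidirect_product N K \<phi>"
proof -
  interpret G: group G by fact
  interpret N: group N by fact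
  interpret K: group K by fact
  interpret f: group_hom N G f by unfold_locales (rule f)
  interpret k: group_hom K G k by unfold_locales (rule k)
  obtain \<psi> where \<psi>: "\<And>x a. \<lbrakk>x \<in> carrier K; a \<in> carrier N\<rbrakk> \<Longrightarrow>
      \<psi> x a \<in> carrier N \<and> k x \<otimes> f a = f (\<psi> x a) \<otimes> k x" using norm by metis
  \<comment> \<open>By cancelling \<open>k x\<close> and injectivity of \<open>f\<close>,
    \<open>\<psi> x a\<close> is the only element that satisfies the exchange equation; each law of
    an action then follows by verifying that equation.\<close>
  have \<psi>_eq: "\<psi> x a = b" if "k x \<otimes> f a = f b \<otimes> k x" "x \<in> carrier K" "a \<in> carrier N" "b \<in> carrier N"
    for x a b
  proof -
    have "f (\<psi> x a) = f b" using that \<psi>[of x a] by (metis G.right_cancel f.hom_closed k.hom_closed)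
    then show ?thesis using inj that \<psi>[of x a] by (auto dest: inj_onD)
  qed
  have \<psi>_one: "\<psi> \<one>\<^bsub>K\<^esub> a = a" if "a \<in> carrier N" for a
    by (rule \<psi>_eq) (use that in auto)
  have \<psi>_K: "\<psi> (x \<otimes>\<^bsub>K\<^esub> y) a = \<psi> x (\<psi> y a)"
    if "x \<in> carrier K" "y \<in> carrier K" "a \<in> carrier N" for x y a
  proof (rule \<psi>_eq)
    have "k (x \<otimes>\<^bsub>K\<^esub> y) \<otimes> f a = k x \<otimes> (k y \<otimes> f a)" using that by (simp add: G.m_assoc)
    also have "\<dots> = k x \<otimes> f (\<psi> y a) \<otimes> k y" using that \<psi>[of y a] by (simp add: G.m_assoc)
    also have "\<dots> = f (\<psi> x (\<psi> y a)) \<otimes> k (x \<otimes>\<^bsub>K\<^esub> y)"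
      using that \<psi>[of y a] \<psi>[of x "\<psi> y a"] by (simp add: G.m_assoc)
    finally show "k (x \<otimes>\<^bsub>K\<^esub> y) \<otimes> f a = f (\<psi> x (\<psi> y a)) \<otimes> k (x \<otimes>\<^bsub>K\<^esub> y)" .
  qed (use that \<psi> in auto)
  have \<psi>_N: "\<psi> x (a \<otimes>\<^bsub>N\<^esub> b) = \<psi> x a \<otimes>\<^bsub>N\<^esub> \<psi> x b"
    if "x \<in> carrier K" "a \<in> carrier N" "b \<in> carrier N" for x a b
  proof (rule \<psi>_eq)
    have "k x \<otimes> f (a \<otimes>\<^bsub>N\<^esub> b) = k x \<otimes> f a \<otimes> f b" using that by (simp add: G.m_assoc)
    also have "\<dots> = f (\<psi> x a) \<otimes> (k x \<otimes> f b)" using that \<psi>[of x a] by (simp add: G.m_assoc)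
    also have "\<dots> = f (\<psi> x a \<otimes>\<^bsub>N\<^esub> \<psi> x b) \<otimes> k x"
      using that \<psi>[of x a] \<psi>[of x b] by (simp add: G.m_assoc)
    finally show "k x \<otimes> f (a \<otimes>\<^bsub>N\<^esub> b) = f (\<psi> x a \<otimes>\<^bsub>N\<^esub> \<psi> x b) \<otimes> k x" .
  qed (use that \<psi> in auto)
  \<comment> \<open>Elements of \<open>AutoGroup N\<close> are extensional functions, whence the
    restriction.\<close>
  define \<phi> where "\<phi> x = restrict (\<psi> x) (carrier N)" for x
  have Bij: "\<phi> x \<in> Bij (carrier N)" if x: "x \<in> carrier K" for x
  proof -
    have "bij_betw (\<phi> x) (carrier N) (carrier N)"
    proof (rule bij_betw_byWitness[where f' = "\<psi> (inv\<^bsub>K\<^esub> x)"])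
      show "\<forall>a\<in>carrier N. \<psi> (inv\<^bsub>K\<^esub> x) (\<phi> x a) = a"
        using x \<psi>_K[of "inv\<^bsub>K\<^esub> x" x] by (auto simp: \<phi>_def \<psi>_one)
      show "\<forall>a\<in>carrier N. \<phi> x (\<psi> (inv\<^bsub>K\<^esub> x) a) = a"
        using x \<psi>_K[of x "inv\<^bsub>K\<^esub> x"] \<psi>[of "inv\<^bsub>K\<^esub> x"] by (auto simp: \<phi>_def \<psi>_one)
    qed (use x \<psi> in \<open>auto simp: \<phi>_def\<close>)
    then show ?thesis by (auto simp: Bij_def \<phi>_def)
  qed
  have auto: "\<phi> x \<in> auto N" if x: "x \<in> carrier K" for x
    using Bij[OF x] x \<psi> by (auto simp: auto_def hom_def \<phi>_def \<psi>_N)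
  have "\<phi> \<in> hom K (AutoGroup N)"
  proof (rule homI)
    show "\<phi> x \<in> carrier (AutoGroup N)" if "x \<in> carrier K" for x
      using auto[OF that] by (simp add: AutoGroup_def)
    show "\<phi> (x \<otimes>\<^bsub>K\<^esub> y) = \<phi> x \<otimes>\<^bsub>AutoGroup N\<^esub> \<phi> y" if "x \<in> carrier K" "y \<in> carrier K" for x y
      using Bij[OF that(1)] Bij[OF that(2)] that \<psi> \<psi>_K
      by (auto simp: AutoGroup_def BijGroup_def compose_def \<phi>_def fun_eq_iff)
  qed
  moreover have "G \<cong> semidirect_product N K \<phi>"
  proof -
    let ?S = "semidirect_product N K \<phi>"
    define h where "h = (\<lambda>(a, x). f a \<otimes> k x)"
    have carrier: "carrier ?S = carrier N \<times> carrier K" by (simp add: semidirect_product_def)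
    have inj_h: "inj_on h (carrier ?S)"
    proof (rule inj_onI, clarsimp simp: carrier h_def)
      fix a x b y assume *: "a \<in> carrier N" "x \<in> carrier K" "b \<in> carrier N" "y \<in> carrier K"
        and eq: "f a \<otimes> k x = f b \<otimes> k y"
      \<comment> \<open>Equal products put the image of the quotient of \<open>y\<close> and
        \<open>x\<close> into the image of \<open>f\<close>, where \<open>triv\<close>
        applies.\<close>
      have "k (y \<otimes>\<^bsub>K\<^esub> inv\<^bsub>K\<^esub> x) = inv f b \<otimes> (f b \<otimes> k y) \<otimes> inv k x"
        using * by (simp add: G.m_assoc[symmetric])
      also have "\<dots> = f (inv\<^bsub>N\<^esub> b \<otimes>\<^bsub>N\<^esub> a)"
        unfolding eq[symmetric] using * by (simp add: G.m_assoc)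
      finally have "y \<otimes>\<^bsub>K\<^esub> inv\<^bsub>K\<^esub> x = \<one>\<^bsub>K\<^esub>" by (rule triv[rotated 2]) (use * in simp_all)
      then have "x = y" using * by (metis K.inv_closed K.inv_equality K.inv_inv)
      moreover have "f a = f b" using eq * unfolding \<open>x = y\<close> by simp
      then have "a = b" using inj * by (auto dest: inj_onD)
      ultimately show "a = b \<and> x = y" by simp
    qed
    have hom_h: "h (u \<otimes>\<^bsub>?S\<^esub> v) = h u \<otimes> h v" if "u \<in> carrier ?S" "v \<in> carrier ?S" for u v
    proof -
      obtain a x b y where *: "u = (a, x)" "v = (b, y)" by (metis surj_pair)
      have **: "a \<in> carrier N" "x \<in> carrier K" "b \<in> carrier N" "y \<in> carrier K"
        using that by (auto simp: * carrier)
      have "h (u \<otimes>\<^bsub>?S\<^esub> v) = f a \<otimes> (f (\<psi> x b) \<otimes> k x) \<otimes> k y"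
        using ** \<psi>[of x b] by (simp add: h_def semidirect_product_def * \<phi>_def G.m_assoc)
      also have "\<dots> = f a \<otimes> (k x \<otimes> f b) \<otimes> k y" using ** \<psi>[of x b] by simp
      also have "\<dots> = h u \<otimes> h v" using ** by (simp add: h_def * G.m_assoc)
      finally show ?thesis .
    qed
    have bij_h: "bij_betw h (carrier ?S) (carrier G)"
      using inj_h surj by (fastforce simp: bij_betw_def carrier h_def)
    have closed: "u \<otimes>\<^bsub>?S\<^esub> v \<in> carrier ?S" if "u \<in> carrier ?S" "v \<in> carrier ?S" for u v
      using that \<psi> by (auto simp: semidirect_product_def \<phi>_def)
    \<comment> \<open>The isomorphism is wanted from \<open>G\<close>, so \<open>h\<close> is
      inverted; \<open>closed\<close> allows evaluating the inverse on a product in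
      \<open>?S\<close>.\<close>
    let ?g = "inv_into (carrier ?S) h"
    have bij_g: "bij_betw ?g (carrier G) (carrier ?S)" by (rule bij_betw_inv_into[OF bij_h])
    have "?g \<in> iso G ?S"
    proof (rule isoI[OF homI bij_g])
      show "?g u \<in> carrier ?S" if "u \<in> carrier G" for u
        using that bij_g by (rule bij_betwE[THEN bspec, rotated])
      fix u v assume "u \<in> carrier G" "v \<in> carrier G"
      then obtain u' v' where *: "u' \<in> carrier ?S" "v' \<in> carrier ?S" "u = h u'" "v = h v'"
        unfolding bij_betw_imp_surj_on[OF bij_h, symmetric] by blast
      then have "u \<otimes> v = h (u' \<otimes>\<^bsub>?S\<^esub> v')" by (simp only: hom_h)
      then show "?g (u \<otimes> v) = ?g u \<otimes>\<^bsub>?S\<^esub> ?g v"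
        using * closed by (simp only: inv_into_f_f[OF inj_h])
    qed
    then show ?thesis by (auto simp: is_iso_def)
  qed
  ultimately show ?thesis by blast
qed

subsection \<open>3-cycles in permutation groups\<close>

lemma cycle_of_list_3_apply:
  assumes "x \<noteq> y" "y \<noteq> z" "x \<noteq> z"
  shows "cycle_of_list [x, y, z] w =
    (if w = x then y else if w = y then z else if w = z then x else w)"
  using assms by (simp add: transpose_def)

locale permutation_group =
  fixes G :: "('a \<Rightarrow> 'a) set"
  assumes bij: "p \<in> G \<Longrightarrow> bij p"
    and comp: "p \<in> G \<Longrightarrow> q \<in> G \<Longrightarrow> p \<circ> q \<in> G"
    and inv: "p \<in> G \<Longrightarrow> Hilbert_Choice.inv p \<in> G"
begin

definition cyc3 :: "'a \<Rightarrow> 'a \<Rightarrow> 'a \<Rightarrow> bool" where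
  "cyc3 x y z \<longleftrightarrow> distinct [x, y, z] \<and> cycle_of_list [x, y, z] \<in> G"

definition linked :: "'a \<Rightarrow> 'a \<Rightarrow> bool" where
  "linked x y \<longleftrightarrow> x = y \<or> (\<exists>z. cyc3 x y z)"

lemma cyc3_distinct: "cyc3 x y z \<Longrightarrow> x \<noteq> y \<and> y \<noteq> x \<and> y \<noteq> z \<and> z \<noteq> y \<and> x \<noteq> z \<and> z \<noteq> x"
  by (auto simp: cyc3_def)

lemma cyc3_rotate: "cyc3 x y z \<Longrightarrow> cyc3 y z x"
  using cycle_of_list_rotate_independent[of "[x, y, z]" 1] by (auto simp: cyc3_def)

lemma cyc3_conj:
  assumes "cyc3 x y z" "p \<in> G" shows "cyc3 (p x) (p y) (p z)"
proof -
  have "p \<circ> cycle_of_list [x, y, z] \<circ> Hilbert_Choice.inv p = cycle_of_list [p x, p y, p z]"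
    using conjugation_of_cycle[of "[x, y, z]" p] assms bij by (auto simp: cyc3_def)
  then have "cycle_of_list [p x, p y, p z] \<in> G"
    using assms comp inv by (metis cyc3_def)
  moreover have "distinct [p x, p y, p z]"
    using assms bij[OF assms(2)] by (auto simp: cyc3_def bij_def inj_eq)
  ultimately show ?thesis by (simp add: cyc3_def)
qed

text \<open>The square of a 3-cycle is its inverse, so both orientations lie in the group.\<close>

lemma cyc3_swap:
  assumes "cyc3 x y z" shows "cyc3 y x z"
proof -
  let ?c = "cycle_of_list [x, y, z]"
  have "?c \<circ> ?c \<in> G" using assms comp by (auto simp: cyc3_def)
  moreover have "?c \<circ> ?c = cycle_of_list [y, x, z]"
    using assms by (auto simp: cyc3_def fun_eq_iff transpose_def)
  ultimately show ?thesis using assms by (auto simp: cyc3_def)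
qed

text \<open>\<open>p\<close> is the conjugating 3-cycle written out, so that conjugates with shared
  points reduce to a case distinction.\<close>

lemma cyc3_conj_cyc3:
  assumes "cyc3 x y z" "cyc3 u v w"
  defines "p \<equiv> \<lambda>i. if i = u then v else if i = v then w else if i = w then u else i"
  shows "cyc3 (p x) (p y) (p z)"
proof -
  have "cycle_of_list [u, v, w] = p"
    unfolding p_def using cyc3_distinct[OF assms(2)] by (intro ext cycle_of_list_3_apply) auto
  then show ?thesis using assms(1,2) cyc3_conj by (metis cyc3_def)
qed

lemma linked_sym: "linked x y \<Longrightarrow> linked y x"
  using cyc3_swap by (auto simp: linked_def)

text \<open>Conjugating the 3-cycle \<open>(x y z)\<close> by \<open>(y w u)\<close> gives a 3-cycle through \<open>x\<close> and \<open>w\<close>.\<close>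

lemma linked_trans:
  assumes "linked x y" "linked y w" shows "linked x w"
proof (cases "x = y \<or> y = w \<or> x = w")
  case False
  then obtain z u where z: "cyc3 x y z" and u: "cyc3 y w u"
    using assms by (auto simp: linked_def)
  show ?thesis
  proof (cases "x = u")
    case True
    then show ?thesis using u cyc3_rotate by (metis linked_def linked_sym)
  next
    case False': False
    then show ?thesis
      using cyc3_conj_cyc3[OF z u] False cyc3_distinct[OF z] cyc3_distinct[OF u]
      by (auto simp: linked_def)
  qed
qed (use assms in \<open>auto simp: linked_def\<close>)

text \<open>Conjugating (x y u) by (x z u) gives (z y x), the inverse of the desired cycle.\<close>

lemma cyc3_shared_pair:
  assumes "cyc3 x y u" "cyc3 x z u" "y \<noteq> z" shows "cyc3 x y z"
proof -
  have "cyc3 z y x"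
    using cyc3_conj_cyc3[OF assms(1,2)] assms(3) cyc3_distinct[OF assms(1)] cyc3_distinct[OF assms(2)]
    by simp
  then show ?thesis using cyc3_rotate cyc3_swap by blast
qed

text \<open>The links supply 3-cycles (x y u) and (y z v). If \<open>u = z\<close> or
  \<open>v = x\<close>, one of them is already enough; if \<open>u = v\<close>, they share two
  points; otherwise conjugating the first by the second gives (x z u), which shares \<open>x\<close>
  and \<open>u\<close> with the first.\<close>

lemma cyc3_if_linked:
  assumes "linked x y" "linked y z" "distinct [x, y, z]" shows "cyc3 x y z"
proof -
  obtain u v where u: "cyc3 x y u" and v: "cyc3 y z v" using assms by (auto simp: linked_def)
  consider "u = z" | "v = x" | "u = v" "u \<noteq> z" "v \<noteq> x" | "u \<noteq> v" "u \<noteq> z" "v \<noteq> x" by blast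
  then show ?thesis
  proof cases
    case 1 then show ?thesis using u by simp
  next
    case 2 then show ?thesis using v cyc3_rotate by blast
  next
    case 3
    then have "cyc3 y x z" using cyc3_shared_pair[of y x u z] cyc3_swap[OF u] v assms by simp
    then show ?thesis by (rule cyc3_swap)
  next
    case 4
    have "cyc3 x z u"
      using cyc3_conj_cyc3[OF u v] 4 cyc3_distinct[OF u] cyc3_distinct[OF v] assms(3) by simp
    then show ?thesis using cyc3_shared_pair[OF u] assms(3) by simp
  qed
qed

end

subsection \<open>An \<open>n\<close>-cycle and a 3-cycle\<close>

lemma mult_in_additive_set:
  fixes S :: "nat set"
  assumes "0 \<in> S" "\<And>x y. x \<in> S \<Longrightarrow> y \<in> S \<Longrightarrow> x + y \<in> S" "c \<in> S" "c dvd h"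
  shows "h \<in> S"
proof -
  have "c * k \<in> S" for k by (induction k) (use assms in auto)
  then show ?thesis using assms(4) by (auto elim: dvdE)
qed

text \<open>Cancellation takes the place of subtraction: Bezout gives
  \<open>a * x = b * y + gcd a b\<close>, and \<open>b * y\<close> is cancelled. This form of Bezout
  needs \<open>a \<noteq> 0\<close>; for \<open>a = 0\<close> the gcd is \<open>b\<close>.\<close>

lemma gcd_in_cancellative_set:
  fixes S :: "nat set"
  assumes zero: "0 \<in> S" and add: "\<And>x y. x \<in> S \<Longrightarrow> y \<in> S \<Longrightarrow> x + y \<in> S"
    and cancel: "\<And>x y. x + y \<in> S \<Longrightarrow> x \<in> S \<Longrightarrow> y \<in> S"
    and "a \<in> S" "b \<in> S"
  shows "gcd a b \<in> S"
proof (cases "a = 0")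
  case False
  then obtain x y where xy: "a * x = b * y + gcd a b" using bezout_nat by blast
  have mult: "c * k \<in> S" if "c \<in> S" for c k
    by (rule mult_in_additive_set[OF zero add that]) simp_all
  show ?thesis
  proof (rule cancel)
    show "b * y + gcd a b \<in> S" unfolding xy[symmetric] by (rule mult[OF assms(4)])
  qed (rule mult[OF assms(5)])
qed (simp add: assms(5))

section \<open>The standard \<open>m\<close>-cycle and its sign\<close>

definition long_cycle :: "nat \<Rightarrow> nat \<Rightarrow> nat" where
  "long_cycle m = cycle_of_list [1..<Suc m]"

lemma long_cycle_permutes: "long_cycle m permutes {1..m}"
  using cycle_permutes[of "[1..<Suc m]"] by (simp add: long_cycle_def atLeastLessThanSuc_atLeastAtMost del: upt_Suc)

lemma long_cycle_apply:
  assumes "q \<in> {1..m}" shows "long_cycle m q = (if q = m then 1 else Suc q)"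
proof -
  let ?l = "[1..<Suc m]"
  have "map (long_cycle m) ?l = rotate1 ?l"
    using cyclic_rotation[of ?l 1] by (simp add: long_cycle_def)
  then have "map (long_cycle m) ?l ! (q - 1) = rotate1 ?l ! (q - 1)" by simp
  moreover have "?l ! (q - 1) = q" using assms by (subst nth_upt) auto
  moreover have "q - 1 < length ?l" using assms by (auto simp del: upt_Suc)
  ultimately have "long_cycle m q = ?l ! (Suc (q - 1) mod length ?l)"
    by (simp add: nth_rotate1 del: upt_Suc)
  then show ?thesis using assms by (auto simp del: upt_Suc simp: nth_upt)
qed

text \<open>A cycle of length \<open>m\<close> is a product of \<open>m - 1\<close>
  transpositions.\<close>

lemma evenperm_long_cycle:
  assumes "m > 0" shows "evenperm (long_cycle m) \<longleftrightarrow> odd m"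
proof -
  have "swapidseq (length [1..<Suc m] - 1) (long_cycle m)"
    unfolding long_cycle_def
    by (rule swapidseq_ext_imp_swapidseq[OF swapidseq_ext_of_cycles]) (rule distinct_upt)
  then show ?thesis using evenperm_unique[of "m - 1" "long_cycle m"] assms by simp
qed

text \<open>The index \<open>k\<close> of \<open>\<theta> k\<close> counts modulo \<open>n\<close> along the \<open>n\<close>-cycle \<open>Z\<close>.\<close>

locale rotation_and_3cycle =
  fixes n A B C :: nat and G :: "(nat \<Rightarrow> nat) set" and \<theta> Z :: "nat \<Rightarrow> nat"
  assumes pos: "0 < A" "0 < B" "0 < C" and n: "n = A + B + C"
    and \<theta>_bij: "bij_betw \<theta> {..<n} {1..n}" and \<theta>_period: "\<theta> (k + n) = \<theta> k"
    and Z: "Z (\<theta> k) = \<theta> (Suc k)"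
    and subgroup: "subgroup G (sym_group n)"
    and Z_in: "Z \<in> G" and cycle_in: "cycle_of_list [\<theta> 0, \<theta> B, \<theta> (B + C)] \<in> G"
begin

lemma permutes: "p \<in> G \<Longrightarrow> p permutes {1..n}"
  using subgroup.subset[OF subgroup] by (auto simp: sym_group_def)

sublocale permutation_group G
proof
  show "bij p" if "p \<in> G" for p using permutes[OF that] by (rule permutes_bij)
  show "p \<circ> q \<in> G" if "p \<in> G" "q \<in> G" for p q
    using subgroup.m_closed[OF subgroup that] by (simp add: sym_group_mult)
  show "Hilbert_Choice.inv p \<in> G" if "p \<in> G" for p
    using subgroup.m_inv_closed[OF subgroup that] permutes[OF that] by (simp add: sym_group_carrier)
qed

lemma id_in: "id \<in> G"
  using subgroup.one_closed[OF subgroup] by (simp add: sym_group_one)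

lemma funpow_in: "p \<in> G \<Longrightarrow> p ^^ k \<in> G"
  by (induction k) (auto simp: id_in comp)

definition d where "d = Gcd {A, B, C}"
definition m where "m = n div d"

lemma d_pos: "0 < d" using pos by (simp add: d_def)
lemma d_dvd: "d dvd A" "d dvd B" "d dvd C"
  unfolding d_def by (intro Gcd_dvd; simp)+
lemma md: "m * d = n"
proof -
  have "d dvd n" unfolding n by (intro dvd_add d_dvd)
  then show ?thesis by (simp add: m_def)
qed
lemma m_ge: "3 \<le> m"
proof -
  have "d \<le> A" "d \<le> B" "d \<le> C" using pos d_dvd by (auto intro: dvd_imp_le)
  then have "3 * d \<le> m * d" using md n by simp
  then show ?thesis using d_pos by simp
qed

text \<open>The shifts \<open>S\<close> that link every index to its image behave like a subgroup of
  the integers: transitivity and symmetry of links give sums and cancellation. Hence it is enough to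
  find \<open>A\<close>, \<open>B\<close> and \<open>C\<close> in \<open>S\<close>.\<close>

lemma linked_shift:
  assumes "d dvd h" shows "linked (\<theta> k) (\<theta> (k + h))"
proof -
  define S where "S = {h. \<forall>k. linked (\<theta> k) (\<theta> (k + h))}"
  have zero: "0 \<in> S" by (simp add: S_def linked_def)
  have add: "x + y \<in> S" if "x \<in> S" "y \<in> S" for x y
  proof -
    have "linked (\<theta> k) (\<theta> (k + x + y))" for k
      using that linked_trans[of "\<theta> k" "\<theta> (k + x)"] by (simp add: S_def)
    then show ?thesis by (simp add: S_def add.assoc)
  qed
  have cancel: "y \<in> S" if "x + y \<in> S" "x \<in> S" for x y
  proof -
    have "linked (\<theta> k) (\<theta> (k + y))" for k
    proof (rule linked_trans)
      show "linked (\<theta> k) (\<theta> (k + y + x))" using that(1) by (simp add: S_def ac_simps)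
      show "linked (\<theta> (k + y + x)) (\<theta> (k + y))" using that(2) linked_sym by (simp add: S_def)
    qed
    then show ?thesis by (simp add: S_def)
  qed
  have "distinct [\<theta> 0, \<theta> B, \<theta> (B + C)]"
    using pos n by (simp add: bij_betw_imp_inj_on[OF \<theta>_bij, THEN inj_on_eq_iff])
  then have "cyc3 (\<theta> 0) (\<theta> B) (\<theta> (B + C))" using cycle_in by (simp add: cyc3_def)
  \<comment> \<open>Conjugation by \<open>Z ^^ k\<close> adds \<open>k\<close> to all three indices
    of the 3-cycle.\<close>
  then have "cyc3 ((Z ^^ k) (\<theta> 0)) ((Z ^^ k) (\<theta> B)) ((Z ^^ k) (\<theta> (B + C)))" for k
    by (rule cyc3_conj) (intro funpow_in Z_in)
  moreover have "(Z ^^ k) (\<theta> j) = \<theta> (k + j)" for k j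
    by (induction k) (auto simp: Z)
  ultimately have cyc: "cyc3 (\<theta> k) (\<theta> (k + B)) (\<theta> (k + (B + C)))" for k by simp
  have "B \<in> S" using cyc unfolding S_def linked_def by blast
  have "linked (\<theta> (k + (B + C))) (\<theta> k)" for k
    using cyc3_rotate[OF cyc3_rotate[OF cyc[of k]]] unfolding linked_def by blast
  then have "B + C \<in> S" using linked_sym unfolding S_def by blast
  then have "C \<in> S" using cancel \<open>B \<in> S\<close> by blast
  \<comment> \<open>Shifting by the period \<open>n = A + B + C\<close> is trivial, so
    \<open>A\<close> follows by cancelling \<open>B + C\<close>.\<close>
  have "n \<in> S" by (simp add: S_def \<theta>_period linked_def)
  then have "(B + C) + A \<in> S" by (simp add: n ac_simps)
  then have "A \<in> S" using cancel \<open>B + C \<in> S\<close> by blast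
  have gcd: "gcd a b \<in> S" if "a \<in> S" "b \<in> S" for a b
    by (rule gcd_in_cancellative_set[OF zero add cancel that])
  have "d = gcd A (gcd B C)" by (simp add: d_def)
  then have "d \<in> S" using gcd \<open>A \<in> S\<close> \<open>B \<in> S\<close> \<open>C \<in> S\<close> by metis
  then have "h \<in> S" using mult_in_additive_set[OF zero add _ assms] by blast
  then show ?thesis by (simp add: S_def)
qed

text \<open>
  \<open>E i q\<close> is the \<open>q\<close>-th edge of the \<open>i\<close>-th residue class modulo \<open>d\<close>, both counted from 1;
  \<open>cl\<close> and \<open>ix\<close> recover the class and the index.
\<close>

definition E where "E i q = \<theta> ((q - 1) * d + (i - 1))"
definition "position" where "position x = inv_into {..<n} \<theta> x"
definition cl where "cl x = Suc (position x mod d)"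
definition ix where "ix x = Suc (position x div d)"

lemma index_less:
  assumes "i \<in> {1..d}" "q \<in> {1..m}" shows "(q - 1) * d + (i - 1) < n"
proof -
  have "(q - 1) * d + (i - 1) < (q - 1) * d + d" using assms by auto
  also have "\<dots> = q * d" using assms by (cases q) auto
  also have "\<dots> \<le> m * d" using assms by auto
  finally show ?thesis by (simp add: md)
qed

lemma position_E:
  assumes "i \<in> {1..d}" "q \<in> {1..m}" shows "position (E i q) = (q - 1) * d + (i - 1)"
  unfolding position_def E_def
  by (rule inv_into_f_f) (use assms index_less \<theta>_bij in \<open>auto simp: bij_betw_def\<close>)

lemma E_in: "i \<in> {1..d} \<Longrightarrow> q \<in> {1..m} \<Longrightarrow> E i q \<in> {1..n}"
  unfolding E_def using bij_betwE[OF \<theta>_bij] index_less by blast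

lemma cl_E: "i \<in> {1..d} \<Longrightarrow> q \<in> {1..m} \<Longrightarrow> cl (E i q) = i"
  using position_E[of i q] mod_mult_self3[of "q - 1" d "i - 1"] by (auto simp: cl_def)

lemma ix_E: "i \<in> {1..d} \<Longrightarrow> q \<in> {1..m} \<Longrightarrow> ix (E i q) = q"
  using position_E[of i q] div_mult_self3[of d "q - 1" "i - 1"] by (auto simp: ix_def)

lemma E_eq_iff:
  "i \<in> {1..d} \<Longrightarrow> q \<in> {1..m} \<Longrightarrow> i' \<in> {1..d} \<Longrightarrow> q' \<in> {1..m} \<Longrightarrow> E i q = E i' q' \<longleftrightarrow> i = i' \<and> q = q'"
  by (metis cl_E ix_E)

lemma E_surj:
  assumes "x \<in> {1..n}" shows "cl x \<in> {1..d}" "ix x \<in> {1..m}" "E (cl x) (ix x) = x"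
proof -
  have "position x \<in> {..<n}" "\<theta> (position x) = x"
    using assms inv_into_into[of x \<theta> "{..<n}"] f_inv_into_f[of x \<theta> "{..<n}"]
      bij_betw_imp_surj_on[OF \<theta>_bij] by (auto simp: position_def)
  moreover from this have "position x div d < m" using md by (simp add: less_mult_imp_div_less)
  ultimately show "cl x \<in> {1..d}" "ix x \<in> {1..m}" "E (cl x) (ix x) = x"
    using d_pos by (auto simp: cl_def ix_def E_def Suc_le_eq)
qed

lemma ext_E:
  assumes "\<And>i q. i \<in> {1..d} \<Longrightarrow> q \<in> {1..m} \<Longrightarrow> f (E i q) = g (E i q)"
    and "\<And>x. x \<notin> {1..n} \<Longrightarrow> f x = g x"
  shows "f = g"
  using assms E_surj by (metis ext)

text \<open>\<open>Z\<close> passes from class to class at constant index and advances the index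
  cyclically on the return from class \<open>d\<close> to class 1.\<close>

lemma Z_E:
  assumes "i \<in> {1..d}" "q \<in> {1..m}"
  shows "Z (E i q) = (if i = d then E 1 (long_cycle m q) else E (Suc i) q)"
proof -
  have "Z (E i q) = \<theta> ((q - 1) * d + i)" using assms by (simp add: E_def Z)
  moreover have "\<theta> ((q - 1) * d + d) = E 1 (long_cycle m q)"
  proof (cases "q = m")
    case True
    \<comment> \<open>After the last index the position reaches \<open>m * d = n\<close>, which the
      period identifies with 0.\<close>
    have "(m - 1) * d + d = 0 + n" using md m_ge by (cases m) auto
    then have "\<theta> ((m - 1) * d + d) = \<theta> 0" by (simp only: \<theta>_period)
    then show ?thesis using True assms by (simp add: long_cycle_apply E_def)
  next
    case False
    moreover have "(q - 1) * d + d = q * d" using assms by (cases q) auto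
    ultimately show ?thesis using assms by (simp add: long_cycle_apply E_def)
  qed
  ultimately show ?thesis by (simp add: E_def)
qed

lemma linked_E:
  assumes "i \<in> {1..d}" "q \<in> {1..m}" "q' \<in> {1..m}" shows "linked (E i q) (E i q')"
proof -
  have *: "linked (E i q) (E i q')" if "q \<le> q'" for q q'
  proof -
    define h where "h = (q' - 1) - (q - 1)"
    have "q' - 1 = (q - 1) + h" using that by (simp add: h_def)
    then have "(q' - 1) * d + (i - 1) = (q - 1) * d + (i - 1) + h * d"
      by (simp only: distrib_right add_ac)
    then show ?thesis unfolding E_def by (simp only: linked_shift[OF dvd_triv_right])
  qed
  show ?thesis using *[of q q'] linked_sym[OF *[of q' q]] by (cases "q \<le> q'") auto
qed

section \<open>Permutations acting inside every class\<close>

definition fam :: "(nat \<Rightarrow> nat \<Rightarrow> nat) \<Rightarrow> bool" where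
  "fam a \<longleftrightarrow> (\<forall>i\<in>{1..d}. a i permutes {1..m})"

text \<open>On families satisfying \<open>fam\<close> this is the embedding of a
  \<open>d\<close>-fold product of symmetric groups on \<open>{1..m}\<close> into the symmetric
  group on \<open>{1..n}\<close>, one factor per class.\<close>

definition F :: "(nat \<Rightarrow> nat \<Rightarrow> nat) \<Rightarrow> nat \<Rightarrow> nat" where
  "F a x = (if x \<in> {1..n} then E (cl x) (a (cl x) (ix x)) else x)"

lemma F_E: "i \<in> {1..d} \<Longrightarrow> q \<in> {1..m} \<Longrightarrow> F a (E i q) = E i (a i q)"
  unfolding F_def using E_in[of i q] by (simp only: cl_E ix_E if_True)

lemma F_out: "x \<notin> {1..n} \<Longrightarrow> F a x = x"
  unfolding F_def by (simp only: if_False not_False_eq_True)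

lemma F_cong: "(\<And>i. i \<in> {1..d} \<Longrightarrow> a i = b i) \<Longrightarrow> F a = F b"
  by (rule ext_E) (simp_all only: F_E F_out not_False_eq_True)

lemma F_id: "F (\<lambda>i. id) = id"
  by (rule ext_E) (simp_all only: F_E F_out not_False_eq_True id_apply)

lemma fam_in: "fam a \<Longrightarrow> i \<in> {1..d} \<Longrightarrow> q \<in> {1..m} \<Longrightarrow> a i q \<in> {1..m}"
  unfolding fam_def using permutes_in_image by metis

lemma F_comp: "fam b \<Longrightarrow> F a \<circ> F b = F (\<lambda>i. a i \<circ> b i)"
  by (rule ext_E) (simp_all only: F_E F_out not_False_eq_True fam_in o_apply)

lemma F_eqD:
  assumes "F a = F b" "fam a" "fam b" "i \<in> {1..d}" shows "a i = b i"
proof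
  fix q
  show "a i q = b i q"
  proof (cases "q \<in> {1..m}")
    case True
    then have "E i (a i q) = E i (b i q)" using assms(1,4) by (metis F_E)
    then show ?thesis using E_eq_iff fam_in[OF assms(2,4) True] fam_in[OF assms(3,4) True] assms(4)
      by blast
  next
    case False
    then show ?thesis using assms by (metis fam_def permutes_not_in)
  qed
qed

abbreviation single :: "nat \<Rightarrow> (nat \<Rightarrow> nat) \<Rightarrow> nat \<Rightarrow> nat \<Rightarrow> nat" where
  "single i p \<equiv> \<lambda>j. if j = i then p else id"

lemma fam_single: "p permutes {1..m} \<Longrightarrow> fam (single i p)"
  by (simp add: fam_def permutes_id)

lemma F_single_comp:
  assumes "q permutes {1..m}" shows "F (single i p) \<circ> F (single i q) = F (single i (p \<circ> q))"
  unfolding F_comp[OF fam_single[OF assms]] by (rule F_cong) simp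

lemma F_single_id: "F (single i id) = id"
  using F_cong[of "single i id" "\<lambda>i. id"] by (simp only: F_id if_cancel)

lemma F_single_cycle:
  assumes "i \<in> {1..d}" "x \<in> {1..m}" "y \<in> {1..m}" "z \<in> {1..m}" and dist: "x \<noteq> y" "y \<noteq> z" "x \<noteq> z"
  shows "F (single i (cycle_of_list [x, y, z])) = cycle_of_list [E i x, E i y, E i z]"
proof (rule ext_E)
  have E_dist: "E i x \<noteq> E i y" "E i y \<noteq> E i z" "E i x \<noteq> E i z" using assms by (simp_all add: E_eq_iff)
  fix j q assume j: "j \<in> {1..d}" and q: "q \<in> {1..m}"
  show "F (single i (cycle_of_list [x, y, z])) (E j q) = cycle_of_list [E i x, E i y, E i z] (E j q)"
    unfolding F_E[OF j q] cycle_of_list_3_apply[OF E_dist] if_distrib[of "\<lambda>p. p q"] cycle_of_list_3_apply[OF dist]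
    using assms j q by (simp add: E_eq_iff)
next
  fix w assume w: "w \<notin> {1..n}"
  then have "w \<notin> set [E i x, E i y, E i z]" using E_in assms by auto
  then have "cycle_of_list [E i x, E i y, E i z] w = w" by (rule id_outside_supp)
  then show "F (single i (cycle_of_list [x, y, z])) w = cycle_of_list [E i x, E i y, E i z] w"
    using F_out[OF w] by simp
qed

text \<open>The alternating group is generated by its 3-cycles, and a 3-cycle inside one class lies
  in \<open>G\<close> because the points of a class are pairwise linked. The induction carries this
  to inverses and products.\<close>

lemma F_single_in:
  assumes i: "i \<in> {1..d}" and "p \<in> carrier (alt_group m)"
  shows "F (single i p) \<in> G"
proof -
  have perm: "p permutes {1..m}" if "p \<in> generate (alt_group m) (three_cycles m)" for p
    using that unfolding alt_group_carrier_as_three_cycles[symmetric] alt_group_carrier by blast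
  have three: "F (single i p) \<in> G" if p: "p \<in> three_cycles m" for p
  proof -
    obtain cs where cs: "p = cycle_of_list cs" "distinct cs" "length cs = 3" "set cs \<subseteq> {1..m}"
      using p by blast
    obtain x y z where xyz: "cs = [x, y, z]" using stupid_lemma[OF cs(3)] by blast
    have in_m: "x \<in> {1..m}" "y \<in> {1..m}" "z \<in> {1..m}" and dist: "x \<noteq> y" "y \<noteq> z" "x \<noteq> z"
      using cs(2,4) unfolding xyz by auto
    have "cyc3 (E i x) (E i y) (E i z)"
      using i in_m dist by (intro cyc3_if_linked linked_E) (simp_all add: E_eq_iff)
    then show ?thesis
      unfolding cs(1) xyz F_single_cycle[OF i in_m dist] by (simp add: cyc3_def)
  qed
  have "p \<in> generate (alt_group m) (three_cycles m)"
    using assms by (simp only: alt_group_carrier_as_three_cycles)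
  then show ?thesis
  proof induction
    case one
    show ?case unfolding alt_group_one F_single_id by (rule id_in)
  next
    case (incl h)
    then show ?case by (rule three)
  next
    case (inv h)
    then have h: "h \<in> carrier (alt_group m)" using three_cycles_incl by blast
    then have perm_h: "h permutes {1..m}" by (simp add: alt_group_carrier)
    have "inv' (F (single i h)) = F (single i (inv' h))"
    proof (rule inv_unique_comp)
      show "F (single i h) \<circ> F (single i (inv' h)) = id"
        unfolding F_single_comp[OF permutes_inv[OF perm_h]] permutes_inv_o[OF perm_h] by (rule F_single_id)
      show "F (single i (inv' h)) \<circ> F (single i h) = id"
        unfolding F_single_comp[OF perm_h] permutes_inv_o[OF perm_h] by (rule F_single_id)
    qed
    then show ?case
      using permutation_group.inv[OF permutation_group_axioms three[OF inv]]
      by (simp only: alt_group_inv_equality[OF h])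
  next
    case (eng h1 h2)
    have "F (single i (h1 \<otimes>\<^bsub>alt_group m\<^esub> h2)) = F (single i h1) \<circ> F (single i h2)"
      unfolding alt_group_mult F_single_comp[OF perm[OF eng.hyps(2)]] ..
    then show ?case using comp[OF eng.IH] by (simp only:)
  qed
qed

lemma F_in:
  assumes "\<And>i. i \<in> {1..d} \<Longrightarrow> a i \<in> carrier (alt_group m)"
  shows "F a \<in> G"
proof -
  \<comment> \<open>The family is built up class by class: the first \<open>k\<close> components are
    in place, the others are still the identity.\<close>
  have "F (\<lambda>i. if i \<le> k then a i else id) \<in> G" if "k \<le> d" for k
    using that
  proof (induction k)
    case 0
    have "F (\<lambda>i. if i \<le> 0 then a i else id) = F (\<lambda>i. id)" by (rule F_cong) simp
    then show ?case by (simp only: F_id id_in)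
  next
    case (Suc k)
    have "fam (\<lambda>i. if i \<le> k then a i else id)"
      using assms Suc.prems by (auto simp: fam_def alt_group_carrier permutes_id)
    then have "F (single (Suc k) (a (Suc k))) \<circ> F (\<lambda>i. if i \<le> k then a i else id) =
        F (\<lambda>i. single (Suc k) (a (Suc k)) i \<circ> (if i \<le> k then a i else id))"
      by (rule F_comp)
    also have "\<dots> = F (\<lambda>i. if i \<le> Suc k then a i else id)" by (rule F_cong) (auto simp: le_Suc_eq)
    finally have eq: "F (single (Suc k) (a (Suc k))) \<circ> F (\<lambda>i. if i \<le> k then a i else id) =
        F (\<lambda>i. if i \<le> Suc k then a i else id)" .
    have "Suc k \<in> {1..d}" using Suc.prems by simp
    then have "F (single (Suc k) (a (Suc k))) \<in> G" using assms by (intro F_single_in)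
    then show ?case unfolding eq[symmetric] using Suc by (intro comp) auto
  qed
  from this[of d] have "F (\<lambda>i. if i \<le> d then a i else id) \<in> G" by simp
  moreover have "F (\<lambda>i. if i \<le> d then a i else id) = F a" by (rule F_cong) simp
  ultimately show ?thesis by simp
qed

text \<open>
  On each class \<open>Z ^^ d\<close> is an \<open>m\<close>-cycle. Multiplying \<open>Z\<close> by the even permutation \<open>\<kappa>\<close> of the first class
  replaces this cycle by \<open>\<pi>\<close>, an involution of the same sign.
\<close>

definition \<pi> :: "nat \<Rightarrow> nat" where "\<pi> = (if even m then transpose 1 2 else id)"

lemma \<pi>_permutes: "\<pi> permutes {1..m}"
  unfolding \<pi>_def using m_ge by (auto intro: permutes_swap_id permutes_id)

lemma \<pi>_in: "q \<in> {1..m} \<Longrightarrow> \<pi> q \<in> {1..m}"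
  using \<pi>_permutes by (simp only: permutes_in_image)

lemma \<pi>_\<pi>: "\<pi> (\<pi> q) = q"
  by (simp add: \<pi>_def)

lemma evenperm_\<pi>: "evenperm \<pi> \<longleftrightarrow> odd m"
  by (simp add: \<pi>_def evenperm_swap)

definition \<kappa> where "\<kappa> = \<pi> \<circ> inv' (long_cycle m)"

lemma \<kappa>_alt: "\<kappa> \<in> carrier (alt_group m)"
proof -
  have "permutation \<pi>" "permutation (long_cycle m)"
    using \<pi>_permutes long_cycle_permutes permutation_permutes by blast+
  then have "evenperm \<kappa>"
    using m_ge by (simp add: \<kappa>_def evenperm_comp permutation_inverse evenperm_inv evenperm_\<pi> evenperm_long_cycle)
  then show ?thesis
    unfolding alt_group_carrier \<kappa>_def
    using permutes_compose[OF permutes_inv[OF long_cycle_permutes] \<pi>_permutes] by blast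
qed

definition W where "W = F (single 1 \<kappa>) \<circ> Z"

lemma W_in: "W \<in> G"
  unfolding W_def by (intro comp Z_in F_single_in \<kappa>_alt) (use d_pos in simp)

text \<open>\<open>\<kappa>\<close> acts on the first class only, so \<open>W\<close> can differ
  from \<open>Z\<close> only on class \<open>d\<close>, whose points go to class 1; there
  \<open>\<kappa>\<close> cancels the long cycle and leaves \<open>\<pi>\<close>.\<close>

lemma W_E:
  assumes "i \<in> {1..d}" "q \<in> {1..m}"
  shows "W (E i q) = (if i = d then E 1 (\<pi> q) else E (Suc i) q)"
proof (cases "i = d")
  case True
  have "long_cycle m q \<in> {1..m}" using long_cycle_permutes assms(2) by (simp only: permutes_in_image)
  then have "W (E i q) = E 1 (\<kappa> (long_cycle m q))"
    using True d_pos Z_E[OF assms] by (simp add: W_def F_E)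
  then show ?thesis using True permutes_inverses(2)[OF long_cycle_permutes] by (simp add: \<kappa>_def)
next
  case False
  then show ?thesis using Z_E[OF assms] assms by (simp add: W_def F_E)
qed

lemma W_out: "x \<notin> {1..n} \<Longrightarrow> W x = x"
  using permutes[OF W_in] by (rule permutes_not_in)

lemma W_funpow_E: "Suc k \<le> d \<Longrightarrow> q \<in> {1..m} \<Longrightarrow> (W ^^ k) (E 1 q) = E (Suc k) q"
  by (induction k) (simp_all add: W_E)

lemma W_d_E:
  assumes "i \<in> {1..d}" "q \<in> {1..m}" shows "(W ^^ d) (E i q) = E i (\<pi> q)"
proof -
  have "(W ^^ d) (E 1 q) = E 1 (\<pi> q)" if "q \<in> {1..m}" for q
  proof -
    have "(W ^^ d) (E 1 q) = W ((W ^^ (d - 1)) (E 1 q))" using d_pos by (cases d) auto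
    also have "\<dots> = E 1 (\<pi> q)" using that d_pos W_funpow_E[of "d - 1" q] W_E[of d q] by simp
    finally show ?thesis .
  qed
  note * = this[OF assms(2)]
  \<comment> \<open>Every class is reached from the first by a power of \<open>W\<close>, and powers
    of \<open>W\<close> commute, so the first class decides.\<close>
  have "(W ^^ d) (E i q) = (W ^^ d) ((W ^^ (i - 1)) (E 1 q))"
    using W_funpow_E[of "i - 1" q] assms by simp
  also have "\<dots> = (W ^^ (i - 1)) ((W ^^ d) (E 1 q))"
    by (metis add.commute comp_apply funpow_add)
  also have "\<dots> = E i (\<pi> q)" using W_funpow_E[of "i - 1" "\<pi> q"] * \<pi>_in assms by simp
  finally show ?thesis .
qed

text \<open>The order of \<open>W\<close>: its \<open>d\<close>-th power acts on every class as
  \<open>\<pi>\<close>, which is trivial exactly for odd \<open>m\<close>.\<close>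

definition M where "M = (if even m then 2 * d else d)"

lemma W_M: "W ^^ M = id"
proof (rule ext_E)
  fix i q assume iq: "i \<in> {1..d}" "q \<in> {1..m}"
  show "(W ^^ M) (E i q) = id (E i q)"
  proof (cases "even m")
    case True
    have "(W ^^ M) (E i q) = (W ^^ d) ((W ^^ d) (E i q))"
      using True by (simp add: M_def mult_2 funpow_add)
    then show ?thesis using iq \<pi>_in by (simp add: W_d_E \<pi>_\<pi>)
  next
    case False
    then show ?thesis using iq by (simp add: M_def W_d_E) (simp add: \<pi>_def)
  qed
next
  fix x assume "x \<notin> {1..n}"
  then show "(W ^^ M) x = id x" using permutes_not_in[OF permutes[OF funpow_in[OF W_in]]] by simp
qed

section \<open>The normal factor and its complement\<close>

definition N where "N = product_group {1..d} (\<lambda>_. alt_group m)"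

lemma N_alt: "a \<in> carrier N \<Longrightarrow> i \<in> {1..d} \<Longrightarrow> a i \<in> carrier (alt_group m)"
  unfolding N_def carrier_product_group by (rule PiE_mem)

lemma N_fam: "a \<in> carrier N \<Longrightarrow> fam a"
  unfolding fam_def using N_alt alt_group_carrier by blast

lemma N_in: "a \<in> carrier N \<Longrightarrow> F a \<in> G"
  by (rule F_in) (rule N_alt)

lemma W_F:
  assumes a: "a \<in> carrier N" shows "\<exists>b\<in>carrier N. W \<circ> F a = F b \<circ> W"
proof
  \<comment> \<open>Conjugation by \<open>W\<close> moves the component of class
    \<open>i - 1\<close> to class \<open>i\<close>; the component of class \<open>d\<close> returns
    to class 1 conjugated by \<open>\<pi>\<close>, which is its own inverse.\<close>
  define b where "b = (\<lambda>i\<in>{1..d}. if i = 1 then \<pi> \<circ> a d \<circ> \<pi> else a (i - 1))"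
  have a_alt: "a i \<in> carrier (alt_group m)" if "i \<in> {1..d}" for i
    using a that by (rule N_alt)
  have "\<pi> \<circ> a d \<circ> \<pi> \<in> carrier (alt_group m)"
  proof -
    have *: "a d permutes {1..m}" "evenperm (a d)" using a_alt[of d] d_pos by (simp_all add: alt_group_carrier)
    have "permutation \<pi>" "permutation (a d)"
      using \<pi>_permutes * permutation_permutes by blast+
    then have "evenperm (\<pi> \<circ> a d \<circ> \<pi>)" using * by (simp add: evenperm_comp permutation_compose)
    then show ?thesis
      unfolding alt_group_carrier using permutes_compose[OF \<pi>_permutes permutes_compose[OF *(1) \<pi>_permutes]]
      by (simp add: comp_assoc)
  qed
  moreover have "a (i - 1) \<in> carrier (alt_group m)" if "i \<in> {1..d}" "i \<noteq> 1" for i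
  proof (rule a_alt)
    show "i - 1 \<in> {1..d}" using that unfolding atLeastAtMost_iff by linarith
  qed
  ultimately show "b \<in> carrier N" by (auto simp: N_def b_def simp del: One_nat_def)
  show "W \<circ> F a = F b \<circ> W"
  proof (rule ext_E)
    fix i q assume i: "i \<in> {1..d}" and q: "q \<in> {1..m}"
    note a_in = fam_in[OF N_fam[OF a] i q]
    show "(W \<circ> F a) (E i q) = (F b \<circ> W) (E i q)"
    proof (cases "i = d")
      case True
      then have "b 1 (\<pi> q) = \<pi> (a i q)" using d_pos by (simp add: b_def \<pi>_\<pi>)
      then show ?thesis using True i q a_in d_pos \<pi>_in by (simp add: F_E W_E)
    next
      case False
      then have "b (Suc i) q = a i q" using i by (simp add: b_def)
      then show ?thesis using False i q a_in by (simp add: F_E W_E)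
    qed
  next
    fix x assume "x \<notin> {1..n}"
    then show "(W \<circ> F a) x = (F b \<circ> W) x" by (simp only: o_apply F_out not_False_eq_True W_out)
  qed
qed

lemma W_funpow_F:
  assumes "a \<in> carrier N" shows "\<exists>b\<in>carrier N. W ^^ k \<circ> F a = F b \<circ> W ^^ k"
proof (induction k)
  case (Suc k)
  then obtain b where b: "b \<in> carrier N" "W ^^ k \<circ> F a = F b \<circ> W ^^ k" by blast
  obtain c where c: "c \<in> carrier N" "W \<circ> F b = F c \<circ> W" using W_F[OF b(1)] by blast
  have "W ^^ Suc k \<circ> F a = W \<circ> (W ^^ k \<circ> F a)" by (simp add: comp_assoc)
  also have "\<dots> = (W \<circ> F b) \<circ> W ^^ k" unfolding b by (simp add: comp_assoc)
  also have "\<dots> = F c \<circ> W ^^ Suc k" unfolding c by (simp add: comp_assoc)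
  finally show ?case using c(1) by blast
qed (use assms in auto)

text \<open>The powers of \<open>W\<close> meet the image of \<open>N\<close> only in the identity.
  \<open>F a\<close> preserves all classes, whereas \<open>W ^^ k\<close> with
  \<open>0 < k < d\<close> moves the first one; from \<open>d\<close> on, a parity argument takes
  over.\<close>

lemma W_funpow_eq_F:
  assumes "a \<in> carrier N" "W ^^ k = F a" "k < M" shows "k = 0"
proof (rule ccontr)
  assume "k \<noteq> 0"
  have one: "1 \<in> {1..d}" "1 \<in> {1..m}" using d_pos m_ge by auto
  have a_in: "a 1 q \<in> {1..m}" if "q \<in> {1..m}" for q using fam_in[OF N_fam[OF assms(1)] one(1) that] .
  have W_k: "(W ^^ k) (E 1 q) = E 1 (a 1 q)" if "q \<in> {1..m}" for q
    using assms(2) F_E[OF one(1) that] by simp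
  show False
  proof (cases "k < d")
    case True
    then have "E (Suc k) 1 = E 1 (a 1 1)" using W_k[OF one(2)] W_funpow_E[of k 1] one by simp
    then show False using E_eq_iff[of "Suc k" 1 1 "a 1 1"] True one a_in \<open>k \<noteq> 0\<close> by simp
  next
    case False
    then have "even m" using assms(3) by (auto simp: M_def split: if_splits)
    have less: "k - d < d" using False assms(3) \<open>even m\<close> by (simp add: M_def)
    have eq: "E (Suc (k - d)) (\<pi> q) = E 1 (a 1 q)" if q: "q \<in> {1..m}" for q
    proof -
      have "(W ^^ k) (E 1 q) = (W ^^ (k - d)) ((W ^^ d) (E 1 q))"
        using False by (metis comp_apply funpow_add le_add_diff_inverse2 not_less)
      also have "\<dots> = E (Suc (k - d)) (\<pi> q)" using less W_funpow_E[of "k - d" "\<pi> q"] W_d_E[OF one(1) q] \<pi>_in[OF q] by simp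
      finally show ?thesis using W_k[OF q] by simp
    qed
    \<comment> \<open>Comparing indices forces \<open>a 1 = \<pi>\<close>, which is odd for even
      \<open>m\<close>, while the components of \<open>a\<close> are even.\<close>
    have "a 1 q = \<pi> q" for q
    proof (cases "q \<in> {1..m}")
      case True
      then show ?thesis using E_eq_iff[of "Suc (k - d)" "\<pi> q" 1 "a 1 q"] eq less one \<pi>_in[OF True] a_in[OF True] by simp
    next
      case False
      then show ?thesis using N_fam[OF assms(1)] one(1) \<pi>_permutes by (metis fam_def permutes_not_in)
    qed
    then have "a 1 = \<pi>" by blast
    moreover have "evenperm (a 1)" using N_alt[OF assms(1) one(1)] alt_group_carrier by blast
    ultimately show False using evenperm_\<pi> \<open>even m\<close> by simp
  qed
qed

text \<open>\<open>carrier N\<close> consists of families extensional on \<open>{1..d}\<close>, so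
  witnesses have to be restricted; \<open>F\<close> does not see the difference.\<close>

lemma F_restrict: "F (restrict a {1..d}) = F a"
  by (rule F_cong) simp

lemma single_in_N:
  "p \<in> carrier (alt_group m) \<Longrightarrow> restrict (single 1 p) {1..d} \<in> carrier N"
  by (auto simp: N_def alt_group_carrier permutes_id)

lemma group_N: "group N"
  unfolding N_def by (intro product_group alt_group_is_group)

lemma F_mult: "a \<in> carrier N \<Longrightarrow> b \<in> carrier N \<Longrightarrow> F (a \<otimes>\<^bsub>N\<^esub> b) = F a \<circ> F b"
  unfolding F_comp[OF N_fam] by (rule F_cong) (simp add: N_def alt_group_mult)

lemma W_funpow_mod: "W ^^ (k mod M) = W ^^ k"
proof
  show "(W ^^ (k mod M)) x = (W ^^ k) x" for x by (rule funpow_mod_eq) (simp add: W_M)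
qed

lemma M_pos: "0 < M"
  using d_pos by (simp add: M_def)

lemma W_power_hom:
  assumes "x \<in> carrier (integer_mod_group M)" "y \<in> carrier (integer_mod_group M)"
  shows "W ^^ nat (x \<otimes>\<^bsub>integer_mod_group M\<^esub> y) = W ^^ nat x \<circ> W ^^ nat y"
proof -
  have "0 \<le> x" "0 \<le> y" using assms M_pos by (auto simp: carrier_integer_mod_group)
  then have "nat (x \<otimes>\<^bsub>integer_mod_group M\<^esub> y) = (nat x + nat y) mod M"
    by (simp add: nat_mod_distrib nat_add_distrib)
  then show ?thesis by (simp add: W_funpow_mod funpow_add)
qed

section \<open>The generators as products, and the isomorphism\<close>

lemma cycle_eq_F:
  obtains a where "a \<in> carrier N" "cycle_of_list [\<theta> 0, \<theta> B, \<theta> (B + C)] = F a"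
proof
  \<comment> \<open>\<open>d\<close> divides \<open>B\<close> and \<open>B + C\<close>, so all three
    points lie in the first class; each \<open>Suc\<close> below comes from counting indices from
    1.\<close>
  define b c where "b = B div d" and "c = (B + C) div d"
  have bd: "b * d = B" "c * d = B + C"
    unfolding b_def c_def by (intro dvd_div_mult_self dvd_add d_dvd)+
  have "0 < b * d" "b * d < c * d" "c * d < m * d" unfolding bd md using pos by (simp_all add: n)
  then have bc: "0 < b" "b < c" "c < m" by simp_all
  let ?p = "cycle_of_list [1, Suc b, Suc c]"
  have "?p \<in> three_cycles m" using bc by (intro CollectI exI[of _ "[1, Suc b, Suc c]"]) auto
  then have "?p \<in> carrier (alt_group m)" using three_cycles_incl by blast
  then show "restrict (single 1 ?p) {1..d} \<in> carrier N" by (rule single_in_N)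
  have "F (single 1 ?p) = cycle_of_list [E 1 1, E 1 (Suc b), E 1 (Suc c)]"
    by (rule F_single_cycle) (use d_pos bc in auto)
  then show "cycle_of_list [\<theta> 0, \<theta> B, \<theta> (B + C)] = F (restrict (single 1 ?p) {1..d})"
    unfolding F_restrict by (simp add: E_def bd)
qed

lemma Z_eq_F_W:
  obtains a where "a \<in> carrier N" "Z = F a \<circ> W"
proof
  have \<kappa>: "\<kappa> permutes {1..m}" using \<kappa>_alt by (simp add: alt_group_carrier)
  show "restrict (single 1 (inv' \<kappa>)) {1..d} \<in> carrier N"
    by (intro single_in_N alt_group_inv_closed \<kappa>_alt)
  have "F (single 1 (inv' \<kappa>)) \<circ> W = (F (single 1 (inv' \<kappa>)) \<circ> F (single 1 \<kappa>)) \<circ> Z"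
    by (simp only: W_def comp_assoc)
  also have "\<dots> = Z"
    unfolding F_single_comp[OF \<kappa>] permutes_inv_o[OF \<kappa>] F_single_id by simp
  finally show "Z = F (restrict (single 1 (inv' \<kappa>)) {1..d}) \<circ> W" unfolding F_restrict ..
qed

text \<open>\<open>gen\<close> expresses that \<open>Z\<close> and the 3-cycle generate
  \<open>G\<close>, so writing elements of \<open>G\<close> as products from \<open>N\<close> and
  the powers of \<open>W\<close> has to be checked only for these two.\<close>

theorem G_isomorphic_semidirect_product:
  assumes gen: "\<And>U. \<lbrakk>subgroup U (sym_group n); Z \<in> U; cycle_of_list [\<theta> 0, \<theta> B, \<theta> (B + C)] \<in> U\<rbrakk>
    \<Longrightarrow> G \<subseteq> U"
  shows "\<exists>\<phi>\<in>hom (integer_mod_group M) (AutoGroup N).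
    (sym_group n)\<lparr>carrier := G\<rparr> \<cong> semidirect_product N (integer_mod_group M) \<phi>"
proof -
  let ?S = "sym_group n" and ?K = "integer_mod_group M"
  define k where "k x = W ^^ nat x" for x
  have K: "carrier ?K = {0..<int M}" using M_pos by (simp add: carrier_integer_mod_group)
  \<comment> \<open>Each map is needed twice: into the whole symmetric group, to see that the
    product set is a subgroup, and into \<open>G\<close>, for the semidirect product.\<close>
  have F_hom: "F \<in> hom N ?S" "F \<in> hom N (?S\<lparr>carrier := G\<rparr>)"
    using N_in permutes by (auto intro!: homI simp: F_mult sym_group_mult sym_group_carrier)
  have k_hom: "k \<in> hom ?K ?S" "k \<in> hom ?K (?S\<lparr>carrier := G\<rparr>)"
    using funpow_in[OF W_in] permutes W_power_hom
    by (auto intro!: homI simp: k_def sym_group_mult sym_group_carrier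
        simp del: mult_integer_mod_group)
  have norm: "\<exists>b\<in>carrier N. k x \<circ> F a = F b \<circ> k x" if "a \<in> carrier N" for x a
    unfolding k_def by (rule W_funpow_F[OF that])
  let ?U = "{F a \<otimes>\<^bsub>?S\<^esub> k x |a x. a \<in> carrier N \<and> x \<in> carrier ?K}"
  have "subgroup ?U ?S"
    by (rule subgroup_product_of_homs[OF sym_group_is_group group_N group_integer_mod_group F_hom(1) k_hom(1)])
      (simp only: sym_group_mult norm)
  moreover have "Z \<in> ?U"
  proof -
    obtain a where "a \<in> carrier N" "Z = F a \<circ> W" by (rule Z_eq_F_W)
    \<comment> \<open>\<open>1 mod M\<close> instead of 1, since \<open>M = 1\<close> occurs, namely
      for \<open>d = 1\<close> and odd \<open>m\<close>.\<close>
    moreover have "k (int (1 mod M)) = W" using W_funpow_mod[of 1] by (simp add: k_def)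
    moreover have "int (1 mod M) \<in> carrier ?K" using M_pos by (simp add: K)
    ultimately show ?thesis
      unfolding sym_group_mult by (intro CollectI exI[of _ a] exI[of _ "int (1 mod M)"]) simp
  qed
  moreover have "cycle_of_list [\<theta> 0, \<theta> B, \<theta> (B + C)] \<in> ?U"
  proof -
    obtain a where a: "a \<in> carrier N" "cycle_of_list [\<theta> 0, \<theta> B, \<theta> (B + C)] = F a" by (rule cycle_eq_F)
    have "F a = F a \<circ> k 0" by (simp add: k_def)
    moreover have "0 \<in> carrier ?K" using M_pos by (simp add: K)
    ultimately show ?thesis
      unfolding sym_group_mult a(2) using a(1) by (intro CollectI exI[of _ a] exI[of _ 0]) simp
  qed
  ultimately have surj: "G \<subseteq> ?U" by (rule gen)
  show ?thesis
  proof (rule isomorphic_semidirect_product[OF _ group_N group_integer_mod_group F_hom(2) _ k_hom(2)])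
    show "group (?S\<lparr>carrier := G\<rparr>)"
      by (rule group.subgroup_imp_group[OF sym_group_is_group subgroup])
    show "inj_on F (carrier N)"
    proof (rule inj_onI)
      fix a b assume ab: "a \<in> carrier N" "b \<in> carrier N" "F a = F b"
      show "a = b"
        by (rule PiE_ext[of a "{1..d}" "\<lambda>_. carrier (alt_group m)" b])
          (use ab F_eqD[OF ab(3) N_fam N_fam] in \<open>simp_all add: N_def\<close>)
    qed
    show "\<exists>b\<in>carrier N. k x \<otimes>\<^bsub>?S\<lparr>carrier := G\<rparr>\<^esub> F a = F b \<otimes>\<^bsub>?S\<lparr>carrier := G\<rparr>\<^esub> k x"
      if "a \<in> carrier N" for x a
      using norm[OF that] by (simp add: sym_group_mult)
    show "x = \<one>\<^bsub>?K\<^esub>" if "x \<in> carrier ?K" "a \<in> carrier N" "k x = F a" for x a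
      using W_funpow_eq_F[of a "nat x"] that by (auto simp: k_def K)
    show "carrier (?S\<lparr>carrier := G\<rparr>) \<subseteq>
        {F a \<otimes>\<^bsub>?S\<lparr>carrier := G\<rparr>\<^esub> k x |a x. a \<in> carrier N \<and> x \<in> carrier ?K}"
      using surj by simp
  qed
qed

end

subsection \<open>Plane trees\<close>

lemma orbit_bij_betw_funpow:
  assumes "x \<in> Orbits.orbit f x"
  shows "bij_betw (\<lambda>k. (f ^^ k) x) {..<card (Orbits.orbit f x)} (Orbits.orbit f x)"
    and "(f ^^ card (Orbits.orbit f x)) x = x"
proof -
  define L where "L = funpow_dist1 f x x"
  have bij: "bij_betw (\<lambda>k. (f ^^ k) x) {0..<L} (Orbits.orbit f x)"
    unfolding L_def bij_betw_def
    using inj_on_funpow_dist1[OF assms] orbit_conv_funpow_dist1[OF assms] by simp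
  then have L: "card (Orbits.orbit f x) = L" using bij_betw_same_card by fastforce
  show "bij_betw (\<lambda>k. (f ^^ k) x) {..<card (Orbits.orbit f x)} (Orbits.orbit f x)"
    unfolding L using bij by (simp add: atLeast0LessThan)
  show "(f ^^ card (Orbits.orbit f x)) x = x"
    unfolding L L_def by (rule funpow_dist1_prop[OF assms])
qed

text \<open>\<open>\<tau>\<close> acts in the first step and fixes the points met afterwards, up to
  time \<open>L\<close>.\<close>

lemma funpow_comp_along_orbit:
  assumes "\<tau> x = y" and fixed: "\<And>k. 0 < k \<Longrightarrow> k < L \<Longrightarrow> \<tau> ((\<sigma> ^^ k) y) = (\<sigma> ^^ k) y"
    and "0 < k" "k \<le> L"
  shows "((\<sigma> \<circ> \<tau>) ^^ k) x = (\<sigma> ^^ k) y"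
  using assms(3,4)
proof (induction k)
  case (Suc k)
  then show ?case using assms(1) fixed[of k] by (cases "k = 0") simp_all
qed simp

section \<open>Three orbits merged into one by a 3-cycle\<close>

locale three_orbits =
  fixes n :: nat and \<sigma> :: "nat \<Rightarrow> nat" and a b c :: nat
  assumes \<sigma>: "\<sigma> permutes {1..n}"
    and union: "{1..n} = Orbits.orbit \<sigma> a \<union> Orbits.orbit \<sigma> b \<union> Orbits.orbit \<sigma> c"
    and disjoint: "Orbits.orbit \<sigma> a \<inter> Orbits.orbit \<sigma> b = {}"
      "Orbits.orbit \<sigma> a \<inter> Orbits.orbit \<sigma> c = {}" "Orbits.orbit \<sigma> b \<inter> Orbits.orbit \<sigma> c = {}"
begin

definition "\<tau> = cycle_of_list [a, b, c]"
abbreviation "len x \<equiv> card (Orbits.orbit \<sigma> x)"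
definition "\<theta> k = ((\<sigma> \<circ> \<tau>) ^^ k) a"

lemma self: "x \<in> Orbits.orbit \<sigma> x"
  using \<sigma> by (intro permutation_self_in_orbit) (auto simp: permutation_permutes)

lemma finite_orb: "finite (Orbits.orbit \<sigma> x)"
  by (rule finite_orbit[OF self])

lemma len_pos: "0 < len x"
  using self finite_orb by (auto simp: card_gt_0_iff)

lemma distinct: "a \<noteq> b" "b \<noteq> c" "a \<noteq> c"
  using disjoint self by blast+

lemma \<tau>_apply: "\<tau> x = (if x = a then b else if x = b then c else if x = c then a else x)"
  unfolding \<tau>_def by (rule cycle_of_list_3_apply[OF distinct])

lemma abc_in: "{a, b, c} \<subseteq> {1..n}"
  unfolding union using self by blast

lemma \<tau>_permutes: "\<tau> permutes {1..n}"
  unfolding \<tau>_def using permutes_subset[OF cycle_permutes, of "[a, b, c]"] abc_in by simp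

lemma \<sigma>\<tau>_permutes: "\<sigma> \<circ> \<tau> permutes {1..n}"
  by (rule permutes_compose[OF \<tau>_permutes \<sigma>])

lemma funpow_ne:
  assumes "0 < k" "k < len y" shows "(\<sigma> ^^ k) y \<noteq> y"
proof
  assume "(\<sigma> ^^ k) y = y"
  then have "(\<sigma> ^^ k) y = (\<sigma> ^^ 0) y" by simp
  moreover have "k \<in> {..<len y}" "0 \<in> {..<len y}" using assms by auto
  ultimately have "k = 0"
    by (rule inj_onD[OF bij_betw_imp_inj_on[OF orbit_bij_betw_funpow(1)[OF self]]])
  then show False using assms by simp
qed

lemma disjoint':
  assumes "x \<in> {a, b, c}" "y \<in> {a, b, c}" "x \<noteq> y"
  shows "Orbits.orbit \<sigma> x \<inter> Orbits.orbit \<sigma> y = {}"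
  using assms disjoint disjoint[THEN trans[OF Int_commute]] by (elim insertE emptyE) simp_all

text \<open>Among \<open>a\<close>, \<open>b\<close>, \<open>c\<close> the orbit of \<open>y\<close>
  contains only \<open>y\<close>, so once \<open>\<tau>\<close> has led to \<open>y\<close>, the
  composition follows \<open>\<sigma>\<close> around the whole orbit.\<close>

lemma funpow_\<sigma>\<tau>:
  assumes "y \<in> {a, b, c}" "\<tau> x = y" "0 < k" "k \<le> len y"
  shows "((\<sigma> \<circ> \<tau>) ^^ k) x = (\<sigma> ^^ k) y"
proof (rule funpow_comp_along_orbit[where \<tau> = \<tau>, OF assms(2) _ assms(3,4)])
  fix j assume j: "0 < j" "j < len y"
  have "(\<sigma> ^^ j) y \<in> Orbits.orbit \<sigma> y" by (rule funpow_in_orbit[OF self])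
  then have "(\<sigma> ^^ j) y \<notin> {a, b, c} - {y}"
    using disjoint'[of "(\<sigma> ^^ j) y" y] self[of "(\<sigma> ^^ j) y"] assms(1) by blast
  then show "\<tau> ((\<sigma> ^^ j) y) = (\<sigma> ^^ j) y" using funpow_ne[OF j] by (auto simp: \<tau>_apply)
qed

lemma funpow_len:
  assumes "y \<in> {a, b, c}" "\<tau> x = y" shows "((\<sigma> \<circ> \<tau>) ^^ len y) x = y"
  using funpow_\<sigma>\<tau>[OF assms len_pos order_refl] orbit_bij_betw_funpow(2)[OF self] by simp

text \<open>The walk from \<open>a\<close> goes around the orbit of \<open>b\<close>, then that of
  \<open>c\<close>, then that of \<open>a\<close>, ending each round at the marked point. This
  places \<open>a\<close>, \<open>b\<close>, \<open>c\<close> at the times 0, \<open>len b\<close>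
  and \<open>len b + len c\<close>.\<close>

lemma \<theta>_b: "\<theta> (len b) = b"
  unfolding \<theta>_def by (rule funpow_len) (simp_all add: \<tau>_apply)

lemma \<theta>_c: "\<theta> (len b + len c) = c"
proof -
  have "\<theta> (len b + len c) = ((\<sigma> \<circ> \<tau>) ^^ len c) (\<theta> (len b))"
    unfolding \<theta>_def by (simp add: add.commute[of "len b"] funpow_add)
  also have "\<dots> = c" unfolding \<theta>_b by (rule funpow_len) (use distinct in \<open>simp_all add: \<tau>_apply\<close>)
  finally show ?thesis .
qed

lemma n_eq: "n = len a + len b + len c"
proof -
  have "card {1..n} = len a + len b + len c"
    unfolding union using disjoint by (simp add: card_Un_disjoint finite_orb Int_Un_distrib2)
  then show ?thesis by simp
qed

lemma \<theta>_n: "\<theta> n = a"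
proof -
  have "\<theta> n = ((\<sigma> \<circ> \<tau>) ^^ len a) (\<theta> (len b + len c))"
    unfolding \<theta>_def n_eq by (simp add: add.assoc funpow_add)
  also have "\<dots> = a" unfolding \<theta>_c by (rule funpow_len) (use distinct in \<open>simp_all add: \<tau>_apply\<close>)
  finally show ?thesis .
qed

lemma \<theta>_period: "\<theta> (k + n) = \<theta> k"
  using \<theta>_n unfolding \<theta>_def by (simp add: funpow_add)

lemma orbit_subset_\<theta>:
  assumes "y \<in> {a, b, c}" "\<tau> (\<theta> j) = y" shows "Orbits.orbit \<sigma> y \<subseteq> range \<theta>"
proof
  fix z assume "z \<in> Orbits.orbit \<sigma> y"
  then obtain k where k: "k < len y" "z = (\<sigma> ^^ k) y"
    using orbit_bij_betw_funpow(1)[OF self, of y] by (auto simp: bij_betw_def)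
  \<comment> \<open>Times run from 1 to \<open>len y\<close>: the walk enters the orbit at
    \<open>\<sigma> y\<close> and comes to \<open>y\<close> at the end of the round.\<close>
  have "\<exists>l. 0 < l \<and> l \<le> len y \<and> z = (\<sigma> ^^ l) y"
  proof (cases "k = 0")
    case True
    then show ?thesis using k len_pos[of y] orbit_bij_betw_funpow(2)[OF self, of y]
      by (intro exI[of _ "len y"]) simp
  next
    case False
    then show ?thesis using k by (intro exI[of _ k]) simp
  qed
  then obtain l where "0 < l" "l \<le> len y" "z = (\<sigma> ^^ l) y" by blast
  then have "z = ((\<sigma> \<circ> \<tau>) ^^ l) (\<theta> j)" using funpow_\<sigma>\<tau>[OF assms] by simp
  then have "z = \<theta> (l + j)" by (simp add: \<theta>_def funpow_add)
  then show "z \<in> range \<theta>" by blast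
qed

lemma \<theta>_bij: "bij_betw \<theta> {..<n} {1..n}"
proof -
  have "Orbits.orbit \<sigma> a \<subseteq> range \<theta>"
    by (rule orbit_subset_\<theta>[of _ "len b + len c"]) (use distinct in \<open>simp_all add: \<theta>_c \<tau>_apply\<close>)
  moreover have "Orbits.orbit \<sigma> b \<subseteq> range \<theta>"
    by (rule orbit_subset_\<theta>[of _ 0]) (simp_all add: \<theta>_def \<tau>_apply)
  moreover have "Orbits.orbit \<sigma> c \<subseteq> range \<theta>"
    by (rule orbit_subset_\<theta>[of _ "len b"]) (use distinct in \<open>simp_all add: \<theta>_b \<tau>_apply\<close>)
  ultimately have "{1..n} \<subseteq> range \<theta>" unfolding union by blast
  moreover have "range \<theta> \<subseteq> {1..n}"
  proof -
    have "\<theta> k \<in> {1..n}" for k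
      unfolding \<theta>_def using abc_in permutes_in_image[OF permutes_funpow[OF \<sigma>\<tau>_permutes]] by simp
    then show ?thesis by blast
  qed
  moreover have "\<theta> k \<in> \<theta> ` {..<n}" for k
  proof -
    have "(k mod n) < n" using n_eq len_pos[of a] by simp
    moreover have "\<theta> (k mod n) = \<theta> k"
      unfolding \<theta>_def by (rule funpow_mod_eq) (use \<theta>_n in \<open>simp add: \<theta>_def\<close>)
    ultimately show ?thesis by (metis imageI lessThan_iff)
  qed
  ultimately have image: "\<theta> ` {..<n} = {1..n}" by blast
  \<comment> \<open>A map from \<open>n\<close> indices onto \<open>n\<close> edges is
    injective.\<close>
  moreover have "inj_on \<theta> {..<n}" by (rule eq_card_imp_inj_on) (simp_all add: image)
  ultimately show ?thesis by (simp add: bij_betw_def)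
qed

lemma rotation_and_3cycle:
  assumes G: "subgroup G (sym_group n)" "\<sigma> \<in> G" "\<tau> \<in> G"
  shows "rotation_and_3cycle n (len a) (len b) (len c) G \<theta> (\<sigma> \<circ> \<tau>)"
proof (rule rotation_and_3cycle.intro)
  show "\<sigma> \<circ> \<tau> \<in> G" using subgroup.m_closed[OF G] by (simp add: sym_group_mult)
  show "cycle_of_list [\<theta> 0, \<theta> (len b), \<theta> (len b + len c)] \<in> G"
    using G(3) by (simp only: \<theta>_b \<theta>_c) (simp add: \<theta>_def \<tau>_def)
qed (rule len_pos n_eq \<theta>_bij \<theta>_period G(1) | simp add: \<theta>_def)+

end

section \<open>The white rotation of a tree\<close>

context bicolored_plane_tree
begin

lemma inj_on_black_end: "inj_on (black_end T) (white_star T w)"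
proof (rule inj_onI, rule ccontr)
  fix e f assume e: "e \<in> white_star T w" and f: "f \<in> white_star T w"
    and eq: "black_end T e = black_end T f" and ne: "e \<noteq> f"
  let ?b = "Inl (black_end T e)"
  have "?b \<in> vertices T" using e black_end_in by (auto simp: vertices_def white_star_def)
  then have "is_cycle T ?b [(e, Inr w), (f, ?b)]"
    using e f eq ne by (auto simp: is_cycle_def joins_def white_star_def)
  then show False using acyclic by blast
qed

text \<open>Apart from one white vertex of degree 3 all white vertices are leaves, and the rotation
  fixes the edge of a leaf.\<close>

lemma white_rot_eq_3cycle:
  assumes "image_mset (\<lambda>w. card (white_star T w)) (mset_set (whites T)) = add_mset 3 (replicate_mset k 1)"
  obtains a b c w where "white_star T w = {a, b, c}" "a \<noteq> b" "b \<noteq> c" "a \<noteq> c"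
    "white_rot T = cycle_of_list [a, b, c]"
proof -
  let ?f = "\<lambda>w. card (white_star T w)" and ?\<tau> = "white_rot T"
  have "3 \<in># image_mset ?f (mset_set (whites T))" unfolding assms by simp
  then obtain w where w: "w \<in> whites T" "?f w = 3" using finite_whites by auto
  \<comment> \<open>Splitting off \<open>w\<close> leaves a multiset of ones, so every other white
    vertex has degree 1.\<close>
  have "mset_set (whites T) = add_mset w (mset_set (whites T - {w}))"
    using w finite_whites by (simp add: mset_set.remove)
  then have "image_mset ?f (mset_set (whites T - {w})) = replicate_mset k 1" using assms w by simp
  then have "set_mset (image_mset ?f (mset_set (whites T - {w}))) \<subseteq> {1}" by simp
  then have leaf: "?f v = 1" if "v \<in> whites T" "v \<noteq> w" for v using that finite_whites by auto
  obtain a where a: "a \<in> white_star T w" using w(2) by fastforce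
  then have ae: "a \<in> edge_set T" "white_end T a = w" by (auto simp: white_star_def)
  have orb: "Orbits.orbit ?\<tau> a = white_star T w" using white_rot_cycle[OF ae(1)] ae(2) by simp
  have self: "a \<in> Orbits.orbit ?\<tau> a" unfolding orb by (rule a)
  have bij: "bij_betw (\<lambda>k. (?\<tau> ^^ k) a) {..<3} (white_star T w)" "(?\<tau> ^^ 3) a = a"
    using orbit_bij_betw_funpow[OF self] by (simp_all add: orb w(2))
  let ?b = "?\<tau> a" and ?c = "?\<tau> (?\<tau> a)"
  have 3: "{..<3::nat} = {0, 1, 2}" by auto
  have star: "white_star T w = {a, ?b, ?c}"
    using bij(1) unfolding 3 bij_betw_def by (simp add: numeral_2_eq_2)
  have dist: "a \<noteq> ?b" "?b \<noteq> ?c" "a \<noteq> ?c"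
    using bij(1) unfolding 3 bij_betw_def by (auto simp: numeral_2_eq_2 inj_on_def)
  have "?\<tau> x = cycle_of_list [a, ?b, ?c] x" for x
  proof (cases "x \<in> white_star T w")
    case True
    then have "x = a \<or> x = ?b \<or> x = ?c" using star by blast
    moreover have "?\<tau> ?c = a" using bij(2) by (simp add: numeral_3_eq_3)
    ultimately show ?thesis unfolding cycle_of_list_3_apply[OF dist] using dist by auto
  next
    case False
    then have "x \<noteq> a" "x \<noteq> ?b" "x \<noteq> ?c" using star by blast+
    moreover have "?\<tau> x = x"
    proof (cases "x \<in> edge_set T")
      case True
      then have "white_end T x \<noteq> w" using False by (simp add: white_star_def)
      then have "card (white_star T (white_end T x)) = 1" by (intro leaf white_end_in True)
      moreover have "x \<in> white_star T (white_end T x)" using True by (simp add: white_star_def)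
      ultimately have "white_star T (white_end T x) = {x}" by (auto simp: card_1_singleton_iff)
      then show ?thesis using white_rot_cycle[OF True] by (simp add: orbit_eq_singleton_iff)
    next
      case False
      then show ?thesis using white_rot_permutes permutes_not_in by metis
    qed
    ultimately show ?thesis unfolding cycle_of_list_3_apply[OF dist] by simp
  qed
  then show ?thesis using that[OF star dist] by blast
qed

end

theorem lemma3p2:
  fixes r s t n d :: nat and T :: "('b, 'w) bicolored_map"
  assumes "r > 0" "s > 0" "t > 0"
    and "r \<noteq> s" "r \<noteq> t" "s \<noteq> t"
    and "n = r + s + t"
    and "d = Gcd {r, s, t}"
    and "bicolored_plane_tree T"
    and "passport T = ({#r, s, t#}, add_mset 3 (replicate_mset (n - 3) 1), n)"
  defines "N \<equiv> product_group {1..d} (\<lambda>_. alt_group (n div d))"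
  defines "K \<equiv> integer_mod_group (if even (n div d) then 2 * d else d)"
  shows "\<exists>\<phi> \<in> hom K (AutoGroup N). monodromy_group T \<cong> semidirect_product N K \<phi>"
proof -
  interpret tree: bicolored_plane_tree T by fact
  let ?f = "\<lambda>x. card (black_star T x)"
  have black: "image_mset ?f (mset_set (blacks T)) = {#r, s, t#}"
    and white: "image_mset (\<lambda>w. card (white_star T w)) (mset_set (whites T)) =
      add_mset 3 (replicate_mset (n - 3) 1)"
    and edges: "num_edges T = n"
    using assms(10) by (auto simp: passport_def)
  have edge_set: "edge_set T = {1..n}" by (simp add: edge_set_def edges)
  obtain a b c w where star: "white_star T w = {a, b, c}" and dist: "a \<noteq> b" "b \<noteq> c" "a \<noteq> c"
    and \<tau>: "white_rot T = cycle_of_list [a, b, c]"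
    using tree.white_rot_eq_3cycle[OF white] .
  have in_edges: "a \<in> edge_set T" "b \<in> edge_set T" "c \<in> edge_set T"
    using star by (auto simp: white_star_def)
  let ?e = "black_end T"
  have ne: "?e a \<noteq> ?e b" "?e b \<noteq> ?e c" "?e a \<noteq> ?e c"
    using tree.inj_on_black_end[of w] dist unfolding star by (auto simp: inj_on_def)
  \<comment> \<open>The passport gives three black vertices, and the three edges of
    \<open>\<tau>\<close> have different black ends, so these are all of them.\<close>
  have "size (image_mset ?f (mset_set (blacks T))) = 3" unfolding black by simp
  then have "card (blacks T) = 3" by simp
  moreover have "{?e a, ?e b, ?e c} \<subseteq> blacks T" using in_edges tree.black_end_in by blast
  moreover have "card {?e a, ?e b, ?e c} = 3" using ne by simp
  ultimately have blacks: "blacks T = {?e a, ?e b, ?e c}"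
    using card_subset_eq[OF tree.finite_blacks] by metis
  have orbit: "Orbits.orbit (black_rot T) x = black_star T (?e x)" if "x \<in> edge_set T" for x
    by (rule tree.black_rot_cycle[OF that])
  interpret orb: three_orbits n "black_rot T" a b c
  proof
    show "black_rot T permutes {1..n}" using tree.black_rot_permutes by (simp add: edge_set)
    have "?e x \<in> {?e a, ?e b, ?e c}" if "x \<in> edge_set T" for x
      using tree.black_end_in[OF that] blacks by simp
    then show "{1..n} = Orbits.orbit (black_rot T) a \<union> Orbits.orbit (black_rot T) b \<union> Orbits.orbit (black_rot T) c"
      unfolding edge_set[symmetric] using in_edges by (auto simp: orbit black_star_def)
  qed (use ne in_edges in \<open>auto simp: orbit black_star_def\<close>)
  have \<tau>': "white_rot T = orb.\<tau>" by (simp add: \<tau> orb.\<tau>_def)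
  \<comment> \<open>It does not matter which degree belongs to which of the three edges:
    \<open>d\<close> depends only on the set of degrees.\<close>
  have "{#orb.len a, orb.len b, orb.len c#} = {#r, s, t#}"
    using black ne unfolding blacks by (simp add: orbit in_edges)
  then have "set_mset {#orb.len a, orb.len b, orb.len c#} = set_mset {#r, s, t#}" by (rule arg_cong)
  then have lens: "{orb.len a, orb.len b, orb.len c} = {r, s, t}" by simp
  let ?S = "sym_group n" and ?gens = "{black_rot T, white_rot T}"
  \<comment> \<open>The intersection with the carrier matches the definition of
    \<open>subgroup_generated\<close>.\<close>
  define G where "G = generate ?S (carrier ?S \<inter> ?gens)"
  have carrier: "?gens \<subseteq> carrier ?S"
    using orb.\<sigma> orb.\<tau>_permutes by (simp add: sym_group_carrier \<tau>')
  have "subgroup G ?S"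
    unfolding G_def by (rule group.generate_is_subgroup[OF sym_group_is_group]) blast
  moreover have "black_rot T \<in> G" "white_rot T \<in> G"
    unfolding G_def using carrier by (auto intro: generate.incl)
  ultimately interpret rot: rotation_and_3cycle n "orb.len a" "orb.len b" "orb.len c" G orb.\<theta>
    "black_rot T \<circ> white_rot T"
    unfolding \<tau>' by (intro orb.rotation_and_3cycle)
  have d: "rot.d = d" unfolding rot.d_def lens assms(8) ..
  have m: "rot.m = n div d" unfolding rot.m_def d ..
  have N: "rot.N = N" unfolding rot.N_def N_def d m ..
  have K: "integer_mod_group rot.M = K" unfolding rot.M_def K_def d m ..
  have "monodromy_group T = ?S\<lparr>carrier := G\<rparr>"
    by (simp add: monodromy_group_def subgroup_generated_def edges G_def)
  moreover have "\<exists>\<phi>\<in>hom K (AutoGroup N). ?S\<lparr>carrier := G\<rparr> \<cong> semidirect_product N K \<phi>"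
    unfolding N[symmetric] K[symmetric]
  proof (rule rot.G_isomorphic_semidirect_product)
    fix U assume U: "subgroup U ?S" and "black_rot T \<circ> white_rot T \<in> U"
      and "cycle_of_list [orb.\<theta> 0, orb.\<theta> (orb.len b), orb.\<theta> (orb.len b + orb.len c)] \<in> U"
    then have \<sigma>\<tau>: "black_rot T \<circ> orb.\<tau> \<in> U" and \<tau>U: "orb.\<tau> \<in> U"
      unfolding orb.\<theta>_b orb.\<theta>_c by (simp_all add: orb.\<theta>_def orb.\<tau>_def \<tau>)
    \<comment> \<open>The black rotation is recovered as the \<open>n\<close>-cycle times the
      inverse of the white rotation, so the \<open>n\<close>-cycle and the 3-cycle generate the
      monodromy group.\<close>
    have "inv' orb.\<tau> \<in> U"
      using subgroup.m_inv_closed[OF U \<tau>U] orb.\<tau>_permutes by (simp add: sym_group_carrier)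
    then have "(black_rot T \<circ> orb.\<tau>) \<circ> inv' orb.\<tau> \<in> U"
      using subgroup.m_closed[OF U \<sigma>\<tau>] by (simp add: sym_group_mult)
    then have "black_rot T \<in> U"
      by (simp only: comp_assoc permutes_inv_o[OF orb.\<tau>_permutes] comp_id)
    then show "G \<subseteq> U"
      unfolding G_def using \<tau>U by (intro group.generate_subgroup_incl[OF sym_group_is_group _ U]) (auto simp: \<tau>')
  qed
  ultimately show ?thesis by simp
qed

end
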